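(* Assume the following two hypotheses about the derivability relation $\vdash_{\mathbb{C}}$. (H1) For all $a,b\in\mathbb{N}$ with $a\neq b$, it is not the case that $[p_a,\lnot p_a]\vdash_{\mathbb{C}} p_b$. (H2) For all $a,b\in\mathbb{N}$ with $a\neq b$: if it is not the case that $[p_a,\lnot p_a]\vdash_{\mathbb{C}} p_b$, then it is not the case that $[(p_a\to p_b)\to p_b,\ \lnot p_a]\vdash_{\mathbb{C}} p_b$. Then for all $a,b\in\mathbb{N}$ with $a\neq b$, a contradiction (falsum, $\mathsf{False}$) follows.
   Context: Formulas are generated inductively: an atom $p_n$ for each $n\in\mathbb{N}$; $\lnot A$ for each formula $A$; $A\to B$ for all formulas $A,B$ ($\lnot$ is primitive; there is no $\bot$ in the language). A context $\Gamma$ is a finite list of formulas; $A\in\Gamma$ means list membership; $A,\Gamma$ is the list with $A$ put in front of $\Gamma$. A succedent $S$ is either a single formula or empty (written $\varnothing$). There are two systems, $f\in\{\mathbf{M},\mathbb{C}\}$ (the minimal reading and the Core reading of the fragment). The derivability relation $\Gamma\vdash_f S$ is the inductively defined (least) relation closed under: (Ax) if $A\in\Gamma$ then $\Gamma\vdash_f A$; (L$\lnot$) if $\lnot A\in\Gamma$ and $\Gamma\vdash_f A$, then $\Gamma\vdash_f\varnothing$; (R$\to$) if $A,\Gamma\vdash_f B$ then $\Gamma\vdash_f A\to B$; (L$\to$) if $A\to B\in\Gamma$, $\Gamma\vdash_f A$ and $B,\Gamma\vdash_f S$ ($S$ any succedent), then $\Gamma\vdash_f S$; (R$\to_{\mathbb{C}}$)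 only for $f=\mathbb{C}$: if $A,\Gamma\vdash_{\mathbb{C}}\varnothing$ then $\Gamma\vdash_{\mathbb{C}} A\to B$ (any formula $B$). *)

theory Defs
  imports Main
begin

datatype fm =
    Atom nat
  | Neg fm
  | Imp fm fm  (infixr "\<^bold>\<rightarrow>" 55)

datatype system = Minimal | Core

type_synonym ctxt = "fm list"

text \<open>A succedent is a formula option; \<open>None\<close> is the empty succedent.\<close>

inductive derives :: "system \<Rightarrow> ctxt \<Rightarrow> fm option \<Rightarrow> bool" for f :: system where
  Ax: "A \<in> set \<Gamma> \<Longrightarrow> derives f \<Gamma> (Some A)"
| LNeg: "Neg A \<in> set \<Gamma> \<Longrightarrow> derives f \<Gamma> (Some A) \<Longrightarrow> derives f \<Gamma> None"
| RImp: "derives f (A # \<Gamma>) (Some B) \<Longrightarrow> derives f \<Gamma> (Some (A \<^bold>\<rightarrow> B))"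
| LImp: "(A \<^bold>\<rightarrow> B) \<in> set \<Gamma> \<Longrightarrow> derives f \<Gamma> (Some A) \<Longrightarrow> derives f (B # \<Gamma>) S \<Longrightarrow> derives f \<Gamma> S"
| RImpCore: "f = Core \<Longrightarrow> derives f (A # \<Gamma>) None \<Longrightarrow> derives f \<Gamma> (Some (A \<^bold>\<rightarrow> B))"

end

theory Submission
  imports Defs
begin

text \<open>
  In Core, a contradiction explodes only underneath an implication. A contradictory context yields
  the empty succedent, and no rule turns that directly into an arbitrary formula; but the Core
  rule for implication turns a refutation of \<open>A\<close> into a proof of \<open>A \<^bold>\<rightarrow> B\<close> for any \<open>B\<close>. Once
  \<open>(A \<^bold>\<rightarrow> B) \<^bold>\<rightarrow> B\<close> replaces \<open>A\<close> in the context, that implication can be detached to reach \<open>B\<close>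
  itself. So the sequent whose underivability the two hypotheses together entail is derivable.
\<close>

text \<open>
  Explosion under an implication: adding \<open>A\<close> makes the context contradictory, and the Core rule
  discharges \<open>A\<close> from the resulting empty succedent.
\<close>
lemma Core_Imp_of_Neg:
  assumes "Neg A \<in> set \<Gamma>"
  shows "derives Core \<Gamma> (Some (A \<^bold>\<rightarrow> B))"
proof (rule RImpCore)
  show "derives Core (A # \<Gamma>) None"
    by (rule LNeg[of A]) (use assms in \<open>auto intro: Ax\<close>)
qed simp

lemma Core_detach_Neg:
  "derives Core [(A \<^bold>\<rightarrow> B) \<^bold>\<rightarrow> B, Neg A] (Some B)"
proof (rule LImp[of "A \<^bold>\<rightarrow> B" B])
  show "derives Core [(A \<^bold>\<rightarrow> B) \<^bold>\<rightarrow> B, Neg A] (Some (A \<^bold>\<rightarrow> B))"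
    by (rule Core_Imp_of_Neg) simp
qed (auto intro: Ax)

theorem mainTheorem1:
  assumes H1: "\<forall>a b :: nat. a \<noteq> b \<longrightarrow>
      \<not> derives Core [Atom a, Neg (Atom a)] (Some (Atom b))"
    and H2: "\<forall>a b :: nat. a \<noteq> b \<longrightarrow>
      \<not> derives Core [Atom a, Neg (Atom a)] (Some (Atom b)) \<longrightarrow>
      \<not> derives Core [(Atom a \<^bold>\<rightarrow> Atom b) \<^bold>\<rightarrow> Atom b, Neg (Atom a)] (Some (Atom b))"
  shows "\<forall>a b :: nat. a \<noteq> b \<longrightarrow> False"
  using H1 H2 Core_detach_Neg by blast

end
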